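(* Let $0<\gamma<1$. Then $\{M_n^{(0)}(x;\gamma)\mid n\ge 0\}$ is an orthogonal set with respect to the inner product $$\langle f,g\rangle=f(0)g(0)+\sum_{k=0}^\infty \Delta f(k)\,\Delta g(k)\,\frac{\gamma^k}{1-\gamma},\qquad \Delta f(x)=f(x+1)-f(x).$$ More precisely, $$\langle M_n^{(0)},M_m^{(0)}\rangle=\frac{1}{\gamma^{n}}(n!)^2\,\delta_{n,m}\quad\text{(Kronecker delta)},\qquad n,m\ge 0.$$
   Context: The Meixner polynomials are normalized as $M_n^{(\beta)}(x;\gamma)=(\beta)_n\,{}_2F_1\left(-n,-x;\beta;1-\frac1\gamma\right)$ for $\beta>0$, $0<\gamma<1$. For $\beta=0$ they are defined by $M_0^{(0)}(x;\gamma)=1$ and $M_n^{(0)}(x;\gamma)=\left(1-\frac1\gamma\right)x\,M_{n-1}^{(2)}(x-1;\gamma)$ for $n\ge1$.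
   Formalization: The printed norm fails for n=m≥1 (n=m=1, γ=1/2 gives 4, not 2); proved instead: with the printed weight the norm is (n!)²/γ^{n+1} for n≥1 and 1 for n=0, and the printed formula holds for weight γ^{k+1}/(1-γ). *)

theory Defs
  imports "HOL-Analysis.Analysis"
begin

definition hyp2F1 :: "real \<Rightarrow> real \<Rightarrow> real \<Rightarrow> real \<Rightarrow> real" where
  "hyp2F1 a b c z = eval_fps (fps_hypergeo [a, b] [c] 1) z"

(* Only meant for beta > 0. The series has only finitely many nonzero terms. *)
definition meixner :: "real \<Rightarrow> nat \<Rightarrow> real \<Rightarrow> real \<Rightarrow> real" where
  "meixner \<beta> n \<gamma> x =
     pochhammer \<beta> n * hyp2F1 (- real n) (- x) \<beta> (1 - 1 / \<gamma>)"

(* The case beta = 0. *)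
definition meixner_zero :: "nat \<Rightarrow> real \<Rightarrow> real \<Rightarrow> real" where
  "meixner_zero n \<gamma> x =
     (if n = 0 then 1 else (1 - 1 / \<gamma>) * x * meixner 2 (n - 1) \<gamma> (x - 1))"

definition fwd_diff :: "(real \<Rightarrow> real) \<Rightarrow> real \<Rightarrow> real" where
  "fwd_diff f x = f (x + 1) - f x"

(* Discrete Sobolev form with weight sequence w. The series is a suminf, so the value is
   meaningful only for f, g for which it is summable. The orthogonality of the M_n^(0) is
   insensitive to a constant factor in w, but the norms are not: (n!)^2 / gamma^n for all n
   belongs to w k = gamma^(k+1) / (1 - gamma), whereas w k = gamma^k / (1 - gamma) gives
   (n!)^2 / gamma^(n+1) for n >= 1 and 1 for n = 0. *)
definition sobolev_ip :: "(nat \<Rightarrow> real) \<Rightarrow> (real \<Rightarrow> real) \<Rightarrow> (real \<Rightarrow> real) \<Rightarrow> real" where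
  "sobolev_ip w f g = f 0 * g 0 + (\<Sum>k. fwd_diff f (real k) * fwd_diff g (real k) * w k)"

end

theory Submission
  imports Defs "HOL-Real_Asymp.Real_Asymp"
begin

text \<open>
  Put \<open>z = 1 - 1/\<gamma>\<close> and \<open>P\<^sub>n(x) = \<Sum>\<^sub>j (n choose j) (x choose j) z\<^sup>j\<close>, which is
  \<open>M\<^sub>n\<^sup>(\<^sup>1\<^sup>)(x;\<gamma>) / n!\<close>. Then \<open>M\<^sub>n\<^sub>+\<^sub>1\<^sup>(\<^sup>0\<^sup>) = (n+1)! (P\<^sub>n\<^sub>+\<^sub>1 - P\<^sub>n)\<close>, and
  \<open>\<Delta>(P\<^sub>n\<^sub>+\<^sub>1 - P\<^sub>n) = z P\<^sub>n\<close>, so everything reduces to the sums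
  \<open>S(n,m) = \<Sum>\<^sub>k \<gamma>\<^sup>k P\<^sub>n(k) P\<^sub>m(k)\<close>. The difference equation reads
  \<open>(P\<^sub>n\<^sub>+\<^sub>1 - P\<^sub>n)(k+1) = P\<^sub>n\<^sub>+\<^sub>1(k) - P\<^sub>n(k)/\<gamma>\<close>. Multiplying it by its analogue for \<open>m\<close> and
  summing against \<open>\<gamma>\<^sup>k\<^sup>+\<^sup>1\<close>, the mixed terms on both sides cancel and leave
  \<open>S(n+1,m+1) = S(n,m)/\<gamma>\<close>; likewise \<open>S(n+1,0) = 0\<close>.
\<close>

definition meixner_one_scaled :: "real \<Rightarrow> nat \<Rightarrow> real \<Rightarrow> real" where
  "meixner_one_scaled z n x = (\<Sum>j\<le>n. real (n choose j) * (x gchoose j) * z ^ j)"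

text \<open>The series terminates because \<open>pochhammer (- real n) j\<close> vanishes for j > n.
  Each of the two upper Pochhammer symbols is (-1)^j j! times a binomial coefficient, and the two
  signs cancel.\<close>

lemma hyp2F1_minus_nat:
  "hyp2F1 (- real n) (- x) c z =
     (\<Sum>j\<le>n. real (n choose j) * (x gchoose j) * fact j / pochhammer c j * z ^ j)"
proof -
  have "hyp2F1 (- real n) (- x) c z =
      (\<Sum>j\<le>n. fps_nth (fps_hypergeo [- real n, - x] [c] 1) j * z ^ j)"
    unfolding hyp2F1_def eval_fps_def
    by (rule suminf_finite) (auto simp: pochhammer_of_nat_eq_0_iff)
  also have "\<dots> = (\<Sum>j\<le>n. real (n choose j) * (x gchoose j) * fact j / pochhammer c j * z ^ j)"
  proof (rule sum.cong[OF refl])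
    fix j
    have "real (n choose j) * (x gchoose j) * fact j =
        ((-1) ^ j * (-1) ^ j) * pochhammer (- real n) j * pochhammer (- x) j / fact j"
      by (simp add: binomial_gbinomial gbinomial_pochhammer)
    also have "(-1) ^ j * (-1) ^ j = (1 :: real)"
      by (simp flip: power_mult_distrib)
    finally show "fps_nth (fps_hypergeo [- real n, - x] [c] 1) j * z ^ j =
        real (n choose j) * (x gchoose j) * fact j / pochhammer c j * z ^ j"
      by simp
  qed
  finally show ?thesis .
qed

lemma pochhammer_two: "pochhammer (2 :: real) n = fact (Suc n)"
  using pochhammer_rec[of "1 :: real" n] by (simp add: pochhammer_fact)

text \<open>Pascal's rule in the degree: (n+1 choose j+1) - (n choose j+1) = (n choose j).\<close>

lemma meixner_one_scaled_diff:
  "meixner_one_scaled z (Suc n) x - meixner_one_scaled z n x =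
     (\<Sum>j\<le>n. real (n choose j) * (x gchoose Suc j) * z ^ Suc j)"
proof -
  \<comment> \<open>The extra term is zero since \<open>n choose Suc n\<close> vanishes; now both
    sums have the same range.\<close>
  have "meixner_one_scaled z n x = (\<Sum>j\<le>Suc n. real (n choose j) * (x gchoose j) * z ^ j)"
    by (simp add: meixner_one_scaled_def)
  then show ?thesis
    unfolding meixner_one_scaled_def[of z "Suc n"]
    by (simp only: sum.atMost_Suc_shift binomial_Suc_Suc)
       (simp add: sum.distrib algebra_simps flip: sum_subtractf)
qed

text \<open>For parameter 2 the denominator is (j+1)!, so j!/(j+1)! leaves 1/(j+1). Together with
  the prefactor x this turns (x-1 choose j) into (x choose j+1), which is the form of the previous
  difference.\<close>

lemma meixner_zero_Suc:
  "meixner_zero (Suc n) \<gamma> x =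
     fact (Suc n) * (meixner_one_scaled (1 - 1 / \<gamma>) (Suc n) x - meixner_one_scaled (1 - 1 / \<gamma>) n x)"
proof -
  let ?z = "1 - 1 / \<gamma>"
  have absorb: "x * (x - 1 gchoose j) * (fact j / fact (Suc j)) = x gchoose Suc j" for j
  proof -
    have "fact j / fact (Suc j) = 1 / real (Suc j)"
      unfolding fact_Suc by (simp del: of_nat_Suc)
    then show ?thesis
      by (simp flip: gbinomial_absorption del: of_nat_Suc fact_Suc)
  qed
  have "meixner_zero (Suc n) \<gamma> x = ?z * x * (fact (Suc n) *
      (\<Sum>j\<le>n. real (n choose j) * (x - 1 gchoose j) * fact j / fact (Suc j) * ?z ^ j))"
    unfolding meixner_zero_def meixner_def
    using hyp2F1_minus_nat[of n "x - 1" 2 ?z] by (simp add: pochhammer_two del: fact_Suc)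
  also have "\<dots> = fact (Suc n) * (\<Sum>j\<le>n. real (n choose j) *
      (x * (x - 1 gchoose j) * (fact j / fact (Suc j))) * ?z ^ Suc j)"
    by (simp add: sum_distrib_left mult_ac del: fact_Suc)
  finally show ?thesis
    by (simp only: absorb meixner_one_scaled_diff)
qed

text \<open>Pascal's rule again, now in the variable x: the forward difference of (x choose j+1) is
  (x choose j).\<close>

lemma meixner_one_scaled_fwd_diff:
  "(meixner_one_scaled z (Suc n) (x + 1) - meixner_one_scaled z n (x + 1)) -
   (meixner_one_scaled z (Suc n) x - meixner_one_scaled z n x) = z * meixner_one_scaled z n x"
  unfolding meixner_one_scaled_diff gbinomial_Suc_Suc
  by (simp add: meixner_one_scaled_def sum_distrib_left algebra_simps flip: sum_subtractf)

lemma fwd_diff_meixner_zero_Suc: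
  "fwd_diff (meixner_zero (Suc n) \<gamma>) x =
     fact (Suc n) * (1 - 1 / \<gamma>) * meixner_one_scaled (1 - 1 / \<gamma>) n x"
  unfolding fwd_diff_def meixner_zero_Suc right_diff_distrib[symmetric]
    meixner_one_scaled_fwd_diff by (simp only: mult.assoc)

lemma fwd_diff_meixner_zero_0: "fwd_diff (meixner_zero 0 \<gamma>) x = 0"
  by (simp add: fwd_diff_def meixner_zero_def)

lemma meixner_one_scaled_at_0: "meixner_one_scaled z n 0 = 1"
  by (simp add: meixner_one_scaled_def gbinomial_0_left if_distrib if_distribR cong: if_cong)

text \<open>Polynomial growth is what makes the sums against the geometric weight converge.\<close>

lemma meixner_one_scaled_bigo: "(\<lambda>k. meixner_one_scaled z n (real k)) \<in> O(\<lambda>k. real k ^ n)"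
  unfolding meixner_one_scaled_def
proof (rule big_sum_in_bigo)
  fix j assume "j \<in> {..n}"
  have "real k gchoose j \<le> real k ^ n" if "k \<ge> 1" for k
  proof -
    have "k choose j \<le> k ^ j"
      by (cases "j \<le> k") (simp_all add: binomial_le_pow binomial_eq_0)
    also have "k ^ j \<le> k ^ n"
      using that \<open>j \<in> {..n}\<close> by (intro power_increasing) auto
    finally show ?thesis
      by (simp flip: binomial_gbinomial of_nat_power)
  qed
  then have "(\<lambda>k. real k gchoose j) \<in> O(\<lambda>k. real k ^ n)"
    by (intro bigoI[where c = 1] eventually_sequentiallyI[of 1])
       (simp flip: binomial_gbinomial)
  then show "(\<lambda>k. real (n choose j) * (real k gchoose j) * z ^ j) \<in> O(\<lambda>k. real k ^ n)"
    by simp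
qed

context
  fixes \<gamma> :: real
  assumes \<gamma>: "0 < \<gamma>" "\<gamma> < 1"
begin

private abbreviation P :: "nat \<Rightarrow> nat \<Rightarrow> real" where
  "P n k \<equiv> meixner_one_scaled (1 - 1 / \<gamma>) n (real k)"

lemma summable_meixner_one: "summable (\<lambda>k. P n k * P m k * \<gamma> ^ k)"
proof (rule summable_comparison_test_bigo)
  show "summable (\<lambda>k. norm (1 / real k ^ 2))"
    using inverse_power_summable[of 2, where 'a = real] by (simp add: field_simps)
  have "(\<lambda>k. P n k * P m k * \<gamma> ^ k) \<in> O(\<lambda>k. real k ^ n * real k ^ m * \<gamma> ^ k)"
    by (intro landau_o.big.mult meixner_one_scaled_bigo) auto
  also have "(\<lambda>k. real k ^ n * real k ^ m * \<gamma> ^ k) \<in> O(\<lambda>k. 1 / real k ^ 2)"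
    using \<gamma> by real_asymp
  finally show "(\<lambda>k. P n k * P m k * \<gamma> ^ k) \<in> O(\<lambda>k. 1 / real k ^ 2)" .
qed

text \<open>The forward difference identity rearranged, using z - 1 = -1/\<gamma>.\<close>

lemma meixner_one_step: "P (Suc n) (Suc k) - P n (Suc k) = P (Suc n) k - P n k / \<gamma>"
  using meixner_one_scaled_fwd_diff[of "1 - 1 / \<gamma>" n "real k"]
  by (simp add: algebra_simps)

lemma suminf_meixner_one_Suc_Suc:
  "(\<Sum>k. P (Suc n) k * P (Suc m) k * \<gamma> ^ k) = (\<Sum>k. P n k * P m k * \<gamma> ^ k) / \<gamma>"
proof -
  define S where "S n m = (\<Sum>k. P n k * P m k * \<gamma> ^ k)" for n m
  have S: "(\<lambda>k. P n k * P m k * \<gamma> ^ k) sums S n m" for n m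
    unfolding S_def by (rule summable_sums[OF summable_meixner_one])
  \<comment> \<open>The sum of \<open>f\<close> is computed twice: by expanding the product at k,
    and by expanding \<open>f (Suc k)\<close> after \<open>meixner_one_step\<close>.\<close>
  define f where
    "f k = (P (Suc n) k - P n k) * (P (Suc m) k - P m k) * \<gamma> ^ k" for k
  have "(\<lambda>k. P (Suc n) k * P (Suc m) k * \<gamma> ^ k - P (Suc n) k * P m k * \<gamma> ^ k
      - P n k * P (Suc m) k * \<gamma> ^ k + P n k * P m k * \<gamma> ^ k) sums
      (S (Suc n) (Suc m) - S (Suc n) m - S n (Suc m) + S n m)"
    by (intro sums_add sums_diff S)
  moreover have "P (Suc n) k * P (Suc m) k * \<gamma> ^ k - P (Suc n) k * P m k * \<gamma> ^ k
      - P n k * P (Suc m) k * \<gamma> ^ k + P n k * P m k * \<gamma> ^ k = f k" for k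
    by (simp add: f_def algebra_simps)
  ultimately have *: "f sums (S (Suc n) (Suc m) - S (Suc n) m - S n (Suc m) + S n m)"
    by simp
  have "(\<lambda>k. \<gamma> * (P (Suc n) k * P (Suc m) k * \<gamma> ^ k) - P (Suc n) k * P m k * \<gamma> ^ k
      - P n k * P (Suc m) k * \<gamma> ^ k + P n k * P m k * \<gamma> ^ k / \<gamma>) sums
      (\<gamma> * S (Suc n) (Suc m) - S (Suc n) m - S n (Suc m) + S n m / \<gamma>)"
    by (intro sums_add sums_diff sums_mult sums_divide S)
  moreover have "\<gamma> * (P (Suc n) k * P (Suc m) k * \<gamma> ^ k) - P (Suc n) k * P m k * \<gamma> ^ k
      - P n k * P (Suc m) k * \<gamma> ^ k + P n k * P m k * \<gamma> ^ k / \<gamma> = f (Suc k)" for k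
    unfolding f_def meixner_one_step using \<gamma> by (simp add: field_simps)
  ultimately have "(\<lambda>k. f (Suc k)) sums
      (\<gamma> * S (Suc n) (Suc m) - S (Suc n) m - S n (Suc m) + S n m / \<gamma>)"
    by simp
  \<comment> \<open>All \<open>P n\<close> equal 1 at 0, so the shifted series loses nothing by
    starting at k = 1.\<close>
  moreover have "f 0 = 0"
    by (simp add: f_def meixner_one_scaled_at_0)
  ultimately have "f sums (\<gamma> * S (Suc n) (Suc m) - S (Suc n) m - S n (Suc m) + S n m / \<gamma>)"
    by (simp add: sums_Suc_iff)
  then have "S (Suc n) (Suc m) - S (Suc n) m - S n (Suc m) + S n m =
      \<gamma> * S (Suc n) (Suc m) - S (Suc n) m - S n (Suc m) + S n m / \<gamma>"
    using * sums_unique2 by blast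
  then have "(1 - \<gamma>) * S (Suc n) (Suc m) = (1 - \<gamma>) * (S n m / \<gamma>)"
    using \<gamma> by (simp add: field_simps)
  then have "S (Suc n) (Suc m) = S n m / \<gamma>"
    using \<gamma> by (subst (asm) mult_left_cancel) auto
  then show ?thesis
    by (simp add: S_def)
qed

text \<open>The same double evaluation with a single difference factor: the terms \<open>S n\<close>
  cancel and leave \<open>S (Suc n) = \<gamma> * S (Suc n)\<close>, where \<gamma> < 1.\<close>

lemma suminf_meixner_one_Suc_0: "(\<Sum>k. P (Suc n) k * P 0 k * \<gamma> ^ k) = 0"
proof -
  have P0: "P 0 k = 1" for k
    by (simp add: meixner_one_scaled_def)
  define S where "S n = (\<Sum>k. P n k * \<gamma> ^ k)" for n
  have S: "(\<lambda>k. P n k * \<gamma> ^ k) sums S n" for n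
    unfolding S_def using summable_sums[OF summable_meixner_one[of n 0]] by (simp add: P0)
  define f where "f k = (P (Suc n) k - P n k) * \<gamma> ^ k" for k
  have *: "f sums (S (Suc n) - S n)"
    using sums_diff[OF S[of "Suc n"] S[of n]]
    unfolding f_def by (simp add: algebra_simps)
  have "(\<lambda>k. \<gamma> * (P (Suc n) k * \<gamma> ^ k) - P n k * \<gamma> ^ k) sums (\<gamma> * S (Suc n) - S n)"
    by (intro sums_diff sums_mult S)
  moreover have "\<gamma> * (P (Suc n) k * \<gamma> ^ k) - P n k * \<gamma> ^ k = f (Suc k)" for k
    unfolding f_def meixner_one_step using \<gamma> by (simp add: field_simps)
  moreover have "f 0 = 0"
    by (simp add: f_def meixner_one_scaled_at_0)
  ultimately have "f sums (\<gamma> * S (Suc n) - S n)"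
    by (simp add: sums_Suc_iff)
  then have "S (Suc n) - S n = \<gamma> * S (Suc n) - S n"
    using * sums_unique2 by blast
  then show ?thesis
    using \<gamma> by (simp add: S_def P0)
qed

text \<open>Both indices are lowered together until one is 0. Off the diagonal the other is then
  positive and the sum vanishes; on the diagonal the geometric series remains.\<close>

lemma suminf_meixner_one:
  "(\<Sum>k. P n k * P m k * \<gamma> ^ k) = (if n = m then 1 / (\<gamma> ^ n * (1 - \<gamma>)) else 0)"
proof (induction n arbitrary: m)
  case 0
  show ?case
  proof (cases m)
    case 0
    then show ?thesis
      using \<gamma> by (simp add: meixner_one_scaled_def suminf_geometric)
  next
    case (Suc m')
    then show ?thesis
      using suminf_meixner_one_Suc_0[of m'] by (simp add: mult.commute)
  qed
next
  case (Suc n)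
  show ?case
  proof (cases m)
    case 0
    then show ?thesis
      using suminf_meixner_one_Suc_0 by simp
  next
    case (Suc m')
    then show ?thesis
      using Suc.IH[of m'] \<gamma> by (simp add: suminf_meixner_one_Suc_Suc)
  qed
qed

lemma fwd_diff_meixner_zero_sums:
  "(\<lambda>k. fwd_diff (meixner_zero n \<gamma>) (real k) * fwd_diff (meixner_zero m \<gamma>) (real k) *
      (\<gamma> ^ k / (1 - \<gamma>))) sums (if n = m \<and> n \<noteq> 0 then 1 / \<gamma> ^ (n + 1) * (fact n)\<^sup>2 else 0)"
proof (cases "n = 0 \<or> m = 0")
  case True
  then show ?thesis
    by (auto simp: fwd_diff_meixner_zero_0)
next
  case False
  then obtain n' m' where [simp]: "n = Suc n'" "m = Suc m'"
    by (meson not0_implies_Suc)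
  define c where "c = fact n * fact m * (1 - 1 / \<gamma>)\<^sup>2 / (1 - \<gamma>)"
  have "(\<lambda>k. c * (P n' k * P m' k * \<gamma> ^ k)) sums
      (c * (if n' = m' then 1 / (\<gamma> ^ n' * (1 - \<gamma>)) else 0))"
    unfolding suminf_meixner_one[symmetric]
    by (intro sums_mult summable_sums summable_meixner_one)
  moreover have "c * (if n' = m' then 1 / (\<gamma> ^ n' * (1 - \<gamma>)) else 0) =
      (if n = m \<and> n \<noteq> 0 then 1 / \<gamma> ^ (n + 1) * (fact n)\<^sup>2 else 0)"
  proof -
    \<comment> \<open>The square (1 - \<gamma>)^2 cancels one factor 1 - \<gamma> from the weight
      and one from the norm of \<open>P n'\<close>; the exponent of 1/\<gamma> becomes n' + 2 = n +
      1.\<close>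
    have "(1 - 1 / \<gamma>)\<^sup>2 = ((1 - \<gamma>) / \<gamma>)\<^sup>2"
      using \<gamma> by (simp add: power2_eq_square field_simps)
    then show ?thesis
      using \<gamma> by (simp add: c_def power2_eq_square del: fact_Suc)
  qed
  moreover have "c * (P n' k * P m' k * \<gamma> ^ k) =
      fwd_diff (meixner_zero n \<gamma>) (real k) * fwd_diff (meixner_zero m \<gamma>) (real k) *
      (\<gamma> ^ k / (1 - \<gamma>))" for k
    by (simp add: c_def fwd_diff_meixner_zero_Suc power2_eq_square mult_ac del: fact_Suc)
  ultimately show ?thesis
    by simp
qed

end

lemma meixner_zero_at_0: "meixner_zero n \<gamma> 0 = (if n = 0 then 1 else 0)"
  by (simp add: meixner_zero_def)

theorem mainTheorem6:
  fixes \<gamma> :: real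
  assumes "0 < \<gamma>" and "\<gamma> < 1"
  shows "(\<forall>n m. summable (\<lambda>k. fwd_diff (meixner_zero n \<gamma>) (real k) *
             fwd_diff (meixner_zero m \<gamma>) (real k) * (\<gamma> ^ k / (1 - \<gamma>)))) \<and>
         pairwise (\<lambda>f g. sobolev_ip (\<lambda>k. \<gamma> ^ k / (1 - \<gamma>)) f g = 0)
           {meixner_zero n \<gamma> | n. n \<ge> 0} \<and>
         (\<forall>n m. sobolev_ip (\<lambda>k. \<gamma> ^ k / (1 - \<gamma>)) (meixner_zero n \<gamma>) (meixner_zero m \<gamma>) =
             (if n = m then (if n = 0 then 1 else 1 / \<gamma> ^ (n + 1) * (fact n)\<^sup>2) else 0)) \<and>
         (\<forall>n m. sobolev_ip (\<lambda>k. \<gamma> ^ (k + 1) / (1 - \<gamma>)) (meixner_zero n \<gamma>) (meixner_zero m \<gamma>) =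
             1 / \<gamma> ^ n * (fact n)\<^sup>2 * (if n = m then 1 else 0))"
proof -
  note sums = fwd_diff_meixner_zero_sums[OF assms]
  have ip: "sobolev_ip (\<lambda>k. \<gamma> ^ k / (1 - \<gamma>)) (meixner_zero n \<gamma>) (meixner_zero m \<gamma>) =
      (if n = m then (if n = 0 then 1 else 1 / \<gamma> ^ (n + 1) * (fact n)\<^sup>2) else 0)" for n m
    unfolding sobolev_ip_def sums_unique[OF sums, symmetric] by (simp add: meixner_zero_at_0)
  have "(\<lambda>k. fwd_diff (meixner_zero n \<gamma>) (real k) * fwd_diff (meixner_zero m \<gamma>) (real k) *
      (\<gamma> ^ (k + 1) / (1 - \<gamma>))) sums
      (\<gamma> * (if n = m \<and> n \<noteq> 0 then 1 / \<gamma> ^ (n + 1) * (fact n)\<^sup>2 else 0))" for n m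
    using sums_mult[OF sums, of \<gamma> n m] by (simp add: mult_ac)
  note sums' = sums_unique[OF this, symmetric]
  \<comment> \<open>The extra \<gamma> rescales only the series. For n = m = 0 the value 1 comes
    from the boundary term f(0) g(0) alone and is unchanged; for n = m > 0 that term vanishes and
    the exponent n + 1 drops to n.\<close>
  have ip': "sobolev_ip (\<lambda>k. \<gamma> ^ (k + 1) / (1 - \<gamma>)) (meixner_zero n \<gamma>) (meixner_zero m \<gamma>) =
      1 / \<gamma> ^ n * (fact n)\<^sup>2 * (if n = m then 1 else 0)" for n m
    unfolding sobolev_ip_def sums' using assms by (simp add: meixner_zero_at_0)
  have "pairwise (\<lambda>f g. sobolev_ip (\<lambda>k. \<gamma> ^ k / (1 - \<gamma>)) f g = 0) {meixner_zero n \<gamma> | n. n \<ge> 0}"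
    by (auto simp: pairwise_def ip)
  with sums ip ip' show ?thesis
    by (blast intro: sums_summable)
qed

end
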